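(* Let $R$ be a unital ring. If $R=(S_m(R)^n)^+$, where $m>1$ and $n>1$ are integers, then there exists $N\in\mathbb N$ such that every $x\in R$ can be written as $x=a_1+\cdots+a_N$ for some $a_i\in S_m(R)^{[n]}$.
   Context: Rings are associative. $S_m(x_1,\dots,x_m)=\sum_{\sigma\in\mathrm{Sym}(m)}(-1)^{\sigma}x_{\sigma(1)}\cdots x_{\sigma(m)}\in\mathbb Z\langle x_1,x_2,\dots\rangle$ is the standard polynomial of degree $m$ ($(-1)^\sigma$ is the sign of $\sigma$). $S_m(R)=\{S_m(a_1,\dots,a_m)\mid a_i\in R\}$. $S_m(R)^{[n]}=\{y_1y_2\cdots y_n\mid y_i\in S_m(R)\}$, and $(S_m(R)^n)^+$ is the additive subgroup of $R$ generated by $S_m(R)^{[n]}$. *)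

theory Defs
  imports
    "HOL-Combinatorics.Permutations"
    "HOL-Computational_Algebra.Group_Closure"
begin

(* Unital associative rings are rendered by the sort {ring, monoid_mult} rather than by
   ring_1, because ring_1 requires 0 \<noteq> 1 and would exclude the zero ring. *)

(* Value of the standard polynomial S_m at x 1, ..., x m.  The sign is applied by negation
   because of_int is not available in a ring without 0 \<noteq> 1. *)
definition std_poly :: "nat \<Rightarrow> (nat \<Rightarrow> 'a) \<Rightarrow> 'a::{ring, monoid_mult}"
  where "std_poly m x =
    (\<Sum>\<sigma> | \<sigma> permutes {1..m}.
      let t = prod_list (map (\<lambda>i. x (\<sigma> i)) [1..<Suc m])
      in if evenperm \<sigma> then t else - t)"

definition std_image :: "nat \<Rightarrow> 'a::{ring, monoid_mult} set"
  where "std_image m = range (std_poly m)"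

definition prods_of :: "'a::monoid_mult set \<Rightarrow> nat \<Rightarrow> 'a set"
  where "prods_of X n = {prod_list ys | ys. length ys = n \<and> set ys \<subseteq> X}"

end

theory Submission
  imports Defs
begin

text \<open>
  Write \<open>V = S\<^sub>m(R)\<close> and call a map \<open>f\<close> into \<open>R\<close> bounded if for some \<open>N\<close> all its values are sums
  of exactly \<open>N\<close> elements of \<open>V\<^sup>[\<^sup>n\<^sup>]\<close>.  The set \<open>I\<close> of all \<open>r\<close> for which \<open>x \<mapsto> x r\<close> is bounded is
  a left ideal, and the claim is \<open>1 \<in> I\<close>.  Since the derivation \<open>[\<cdot>, y]\<close> turns a value of \<open>S\<^sub>m\<close>
  into a sum of \<open>m\<close> values of \<open>S\<^sub>m\<close>, the map \<open>x \<mapsto> [x, r]\<close> is a bounded sum of elements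
  of \<open>V\<^sup>[\<^sup>k\<^sup>]\<close> whenever \<open>r\<close> is in the additive span of \<open>V\<^sup>[\<^sup>k\<^sup>]\<close>.  Hence \<open>x [u, r] = [x u, r] - [x, r] u\<close>
  gives \<open>[u, r] \<in> I\<close> for \<open>u\<close> in the span of \<open>V\<close> and \<open>r\<close> in the span \<open>W\<close> of \<open>V\<^sup>[\<^sup>n\<^sup>-\<^sup>1\<^sup>]\<close>.  As these spans
  are Lie ideals, even \<open>[V, W] \<subseteq> J\<close>, where \<open>J\<close> is the largest two-sided ideal inside \<open>I\<close>.  Modulo
  \<open>J\<close> the set \<open>V\<close> commutes with \<open>W\<close>, hence with \<open>R\<close>, which is the span of \<open>W W\<close>; so \<open>R/J\<close>, being
  generated by \<open>V\<close>, is commutative, \<open>S\<^sub>m\<close> vanishes on it, and \<open>R/J = 0\<close>.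
\<close>

section \<open>Commutators and bounded sums\<close>

definition comm :: "'a::ring \<Rightarrow> 'a \<Rightarrow> 'a"
  where "comm x y = x * y - y * x"

lemma comm_diff_left: "comm (x - x') y = comm x y - comm x' y"
  by (simp add: comm_def algebra_simps)

lemma comm_diff_right: "comm x (y - y') = comm x y - comm x y'"
  by (simp add: comm_def algebra_simps)

lemma comm_minus_left: "comm (- x) y = - comm x y"
  by (simp add: comm_def)

lemma comm_sum_left: "comm (\<Sum>i\<in>I. f i) y = (\<Sum>i\<in>I. comm (f i) y)"
  by (simp add: comm_def sum_distrib_left sum_distrib_right sum_subtractf)

lemma comm_mult_left: "comm (x * x') y = comm x y * x' + x * comm x' y"
  by (simp add: comm_def algebra_simps)

lemma comm_mult_right: "comm x (y * y') = comm x y * y' + y * comm x y'"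
  by (simp add: comm_def algebra_simps)

lemma comm_swap: "comm x y = - comm y x"
  by (simp add: comm_def)

lemma comm_zero [simp]: "comm x 0 = 0" "comm 0 x = 0"
  by (simp_all add: comm_def)

lemma comm_jacobi: "comm (comm u r) y = comm (comm u y) r + comm u (comm r y)"
  by (simp add: comm_def algebra_simps)

lemma comm_one [simp]: "comm x (1 :: 'a::{ring, monoid_mult}) = 0"
  by (simp add: comm_def)

text \<open>\<open>N\<close> is chosen before \<open>x\<close>, so every substitution in the
  argument keeps the bound. Demanding exactly \<open>N\<close> summands rather than at most
  \<open>N\<close> matches the final claim, and lengths simply add under \<open>+\<close>.\<close>

definition bounded_sums :: "'a::ab_group_add set \<Rightarrow> ('b \<Rightarrow> 'a) \<Rightarrow> bool"
  where "bounded_sums A f \<longleftrightarrow>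
    (\<exists>N. \<forall>x. \<exists>ys. length ys = N \<and> set ys \<subseteq> A \<and> f x = sum_list ys)"

lemma bounded_sumsI_mem: "(\<And>x. f x \<in> A) \<Longrightarrow> bounded_sums A f"
  unfolding bounded_sums_def
  by (intro exI[of _ 1] allI, rule_tac x = "[f x]" in exI) simp

lemma bounded_sums_zero [simp]: "bounded_sums A (\<lambda>_. 0)"
  unfolding bounded_sums_def by (rule exI[of _ 0]) simp

lemma bounded_sums_compose: "bounded_sums A f \<Longrightarrow> bounded_sums A (\<lambda>x. f (h x))"
  unfolding bounded_sums_def by (elim exE, rule exI, rule allI) (erule spec)

lemma bounded_sums_add:
  assumes "bounded_sums A f" "bounded_sums A g"
  shows "bounded_sums A (\<lambda>x. f x + g x)"
proof -
  obtain N where N: "\<And>x. \<exists>ys. length ys = N \<and> set ys \<subseteq> A \<and> f x = sum_list ys"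
    using assms(1) unfolding bounded_sums_def by blast
  obtain M where M: "\<And>x. \<exists>ys. length ys = M \<and> set ys \<subseteq> A \<and> g x = sum_list ys"
    using assms(2) unfolding bounded_sums_def by blast
  have "\<exists>ys. length ys = N + M \<and> set ys \<subseteq> A \<and> f x + g x = sum_list ys" for x
  proof -
    obtain ys zs where "length ys = N" "set ys \<subseteq> A" "f x = sum_list ys"
      "length zs = M" "set zs \<subseteq> A" "g x = sum_list zs"
      using N[of x] M[of x] by blast
    then show ?thesis
      by (intro exI[of _ "ys @ zs"]) simp
  qed
  then show ?thesis
    unfolding bounded_sums_def by blast
qed

lemma bounded_sums_sum:
  assumes "finite K" "\<And>k. k \<in> K \<Longrightarrow> bounded_sums A (f k)"
  shows "bounded_sums A (\<lambda>x. \<Sum>k\<in>K. f k x)"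
  using assms by (induction K) (simp_all add: bounded_sums_add)

lemma sum_list_map_additive:
  fixes h :: "'a::ab_group_add \<Rightarrow> 'b::ab_group_add"
  assumes "\<And>x y. h (x + y) = h x + h y"
  shows "h (sum_list ys) = sum_list (map h ys)"
proof -
  have "h 0 = 0"
    using assms[of 0 0] by simp
  then show ?thesis
    by (induction ys) (simp_all add: assms)
qed

text \<open>An additive map acts summand by summand and so keeps \<open>N\<close>. It is applied to
  negation and to multiplication by a fixed product on either side.\<close>

lemma bounded_sums_map_additive:
  assumes "bounded_sums A f" and "\<And>x y. h (x + y) = h x + h y" and "h ` A \<subseteq> B"
  shows "bounded_sums B (\<lambda>x. h (f x))"
proof -
  obtain N where N: "\<And>x. \<exists>ys. length ys = N \<and> set ys \<subseteq> A \<and> f x = sum_list ys"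
    using assms(1) unfolding bounded_sums_def by blast
  have "\<exists>ys. length ys = N \<and> set ys \<subseteq> B \<and> h (f x) = sum_list ys" for x
  proof -
    obtain ys where "length ys = N" "set ys \<subseteq> A" "f x = sum_list ys"
      using N[of x] by blast
    then show ?thesis
      using assms(3)
      by (intro exI[of _ "map h ys"]) (auto simp: sum_list_map_additive[OF assms(2)])
  qed
  then show ?thesis
    unfolding bounded_sums_def by blast
qed

lemma bounded_sums_minus:
  assumes "bounded_sums A f" "\<And>a. a \<in> A \<Longrightarrow> - a \<in> A"
  shows "bounded_sums A (\<lambda>x. - f x)"
  using assms(2) by (intro bounded_sums_map_additive[where h = uminus, OF assms(1)]) auto

lemma bounded_sums_diff:
  assumes "bounded_sums A f" "bounded_sums A g" "\<And>a. a \<in> A \<Longrightarrow> - a \<in> A"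
  shows "bounded_sums A (\<lambda>x. f x - g x)"
  using bounded_sums_add[OF assms(1) bounded_sums_minus[OF assms(2,3)]] by simp

lemma bounded_sums_in_group_closure:
  assumes "bounded_sums A f"
  shows "f x \<in> group_closure A"
proof -
  obtain ys where ys: "set ys \<subseteq> A" "f x = sum_list ys"
    using assms unfolding bounded_sums_def by blast
  have "sum_list ys \<in> group_closure A"
    using ys(1) by (induction ys) (auto intro: group_closure_add group_closure.base)
  then show ?thesis
    using ys(2) by simp
qed

section \<open>Products of elements of a set\<close>

lemma prods_of_mult:
  assumes "a \<in> prods_of X k" "b \<in> prods_of X l"
  shows "a * b \<in> prods_of X (k + l)"
proof -
  obtain ys zs where "a = prod_list ys" "length ys = k" "set ys \<subseteq> X"
    "b = prod_list zs" "length zs = l" "set zs \<subseteq> X"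
    using assms unfolding prods_of_def by blast
  then show ?thesis
    unfolding prods_of_def by (intro CollectI exI[of _ "ys @ zs"]) simp
qed

lemma prods_of_Suc_0: "prods_of X (Suc 0) = X"
proof
  show "prods_of X (Suc 0) \<subseteq> X"
    by (auto simp: prods_of_def length_Suc_conv)
  show "X \<subseteq> prods_of X (Suc 0)"
    unfolding prods_of_def by (auto intro!: exI[of _ "[x]" for x])
qed

lemma prods_of_0: "prods_of X 0 = {1}"
  by (auto simp: prods_of_def)

lemma prods_of_SucE:
  assumes "p \<in> prods_of X (Suc k)"
  obtains v q where "p = v * q" "v \<in> X" "q \<in> prods_of X k"
proof -
  obtain v ys where "p = v * prod_list ys" "v \<in> X" "set ys \<subseteq> X" "length ys = k"
    using assms by (auto simp: prods_of_def length_Suc_conv)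
  then show thesis
    by (intro that[of v "prod_list ys"]) (auto simp: prods_of_def)
qed

lemma prods_of_addE:
  assumes "p \<in> prods_of X (k + l)"
  obtains q r where "p = q * r" "q \<in> prods_of X k" "r \<in> prods_of X l"
proof -
  obtain ys where ys: "p = prod_list ys" "length ys = k + l" "set ys \<subseteq> X"
    using assms unfolding prods_of_def by blast
  have "p = prod_list (take k ys) * prod_list (drop k ys)"
    using ys(1) by (simp flip: prod_list.append)
  moreover have "prod_list (take k ys) \<in> prods_of X k" "prod_list (drop k ys) \<in> prods_of X l"
    using ys(2,3) set_take_subset[of k ys] set_drop_subset[of k ys]
    unfolding prods_of_def by fastforce+
  ultimately show thesis
    by (rule that)
qed

text \<open>The first factor absorbs the sign. For \<open>k = 0\<close> there is no factor to do so:
  the only product is 1.\<close>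

lemma prods_of_minus:
  fixes X :: "'a::{ring, monoid_mult} set"
  assumes "\<And>v. v \<in> X \<Longrightarrow> - v \<in> X" and "k > 0" and "p \<in> prods_of X k"
  shows "- p \<in> prods_of X k"
proof -
  obtain j where k: "k = Suc j"
    using assms(2) by (cases k) auto
  obtain v q where p: "p = v * q" "v \<in> X" "q \<in> prods_of X j"
    using assms(3) unfolding k by (rule prods_of_SucE)
  have "- v \<in> prods_of X (Suc 0)"
    using assms(1) p(2) by (simp add: prods_of_Suc_0)
  from prods_of_mult[OF this p(3)] show ?thesis
    by (simp add: p(1) k)
qed

lemma bounded_sums_mult_const:
  fixes X :: "'a::{ring, monoid_mult} set"
  assumes "bounded_sums (prods_of X k) f" "p \<in> prods_of X l"
  shows "bounded_sums (prods_of X (k + l)) (\<lambda>x. f x * p)"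
  using assms
  by (intro bounded_sums_map_additive[where h = "\<lambda>y. y * p", OF assms(1)])
     (auto simp: distrib_right intro: prods_of_mult)

lemma bounded_sums_const_mult:
  fixes X :: "'a::{ring, monoid_mult} set"
  assumes "p \<in> prods_of X k" "bounded_sums (prods_of X l) f"
  shows "bounded_sums (prods_of X (k + l)) (\<lambda>x. p * f x)"
  using assms
  by (intro bounded_sums_map_additive[where h = "\<lambda>y. p * y", OF assms(2)])
     (auto simp: distrib_left intro: prods_of_mult)

section \<open>Additive spans of sets of products\<close>

lemma group_closure_subset:
  assumes "A \<subseteq> T" "0 \<in> T" "\<And>s t. s \<in> T \<Longrightarrow> t \<in> T \<Longrightarrow> s - t \<in> T"
  shows "group_closure A \<subseteq> T"
proof
  fix x assume "x \<in> group_closure A"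
  then show "x \<in> T"
    by induction (use assms in auto)
qed

lemma group_closure_mult_prod:
  fixes X :: "'a::{ring, monoid_mult} set"
  assumes "s \<in> group_closure (prods_of X k)" "p \<in> prods_of X l"
  shows "s * p \<in> group_closure (prods_of X (k + l))"
  using assms(1)
proof induction
  case (base s)
  then show ?case
    using assms(2) by (auto intro: group_closure.base prods_of_mult)
next
  case (diff s t)
  then show ?case
    by (simp add: left_diff_distrib group_closure.diff)
qed

text \<open>In a product \<open>q * v\<close> of \<open>n\<close> factors, \<open>q\<close> is an
  element of R and so, by induction, lies in the span of the products of length
  \<open>n + k\<close>; multiplying by \<open>v\<close> lengthens these by one.\<close>

lemma group_closure_prods_of_add_UNIV:
  fixes X :: "'a::{ring, monoid_mult} set"
  assumes "group_closure (prods_of X n) = UNIV" "n > 0"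
  shows "group_closure (prods_of X (n + k)) = UNIV"
proof (induction k)
  case 0
  then show ?case
    using assms by simp
next
  case (Suc k)
  have "prods_of X n \<subseteq> group_closure (prods_of X (n + Suc k))"
  proof
    fix p assume p: "p \<in> prods_of X n"
    have "n = (n - 1) + Suc 0"
      using assms(2) by simp
    with p obtain q v where qv: "p = q * v" "v \<in> prods_of X (Suc 0)"
      by (metis prods_of_addE)
    have "q \<in> group_closure (prods_of X (n + k))"
      using Suc by simp
    from group_closure_mult_prod[OF this qv(2)] show "p \<in> group_closure (prods_of X (n + Suc k))"
      by (simp add: qv(1))
  qed
  then have "group_closure (prods_of X n) \<subseteq> group_closure (prods_of X (n + Suc k))"
    by (rule group_closure_subset) (simp_all add: group_closure.diff)
  then show ?case
    using assms(1) by auto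
qed

section \<open>Values of the standard polynomial\<close>

abbreviation perm_monomial :: "nat \<Rightarrow> (nat \<Rightarrow> 'a) \<Rightarrow> (nat \<Rightarrow> nat) \<Rightarrow> 'a::monoid_mult"
  where "perm_monomial m x \<sigma> \<equiv> prod_list (map (\<lambda>i. x (\<sigma> i)) [1..<Suc m])"

lemma std_poly_eq:
  "std_poly m x = (\<Sum>\<sigma> | \<sigma> permutes {1..m}.
     if evenperm \<sigma> then perm_monomial m x \<sigma> else - perm_monomial m x \<sigma>)"
  by (simp only: std_poly_def Let_def)

lemma evenperm_transpose_comp:
  assumes "\<sigma> permutes A" "finite A" "a \<noteq> b"
  shows "evenperm (transpose a b \<circ> \<sigma>) \<longleftrightarrow> \<not> evenperm \<sigma>"
    and "evenperm (\<sigma> \<circ> transpose a b) \<longleftrightarrow> \<not> evenperm \<sigma>"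
  using assms permutes_imp_permutation[OF assms(2,1)]
  by (simp_all add: evenperm_comp evenperm_swap permutation_swap_id)

text \<open>S_m is alternating: exchanging its first two arguments, which exist since
  \<open>m > 1\<close>, reverses the sign. Hence differences of bounded sums are again bounded
  sums.\<close>

lemma std_image_minus:
  fixes v :: "'a::{ring, monoid_mult}"
  assumes "m > 1" "v \<in> std_image m"
  shows "- v \<in> std_image m"
proof -
  obtain x where v: "v = std_poly m x"
    using assms(2) unfolding std_image_def by blast
  define \<tau> where "\<tau> = transpose (1::nat) 2"
  have \<tau>: "\<tau> permutes {1..m}"
    unfolding \<tau>_def using assms(1) by (intro permutes_swap_id) auto
  have \<tau>\<tau>: "\<tau> \<circ> (\<tau> \<circ> \<sigma>) = \<sigma>" for \<sigma> :: "nat \<Rightarrow> nat"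
    by (simp add: \<tau>_def fun_eq_iff)
  have "std_poly m (x \<circ> \<tau>) = (\<Sum>\<sigma> | \<sigma> permutes {1..m}.
     - (if evenperm \<sigma> then perm_monomial m x \<sigma> else - perm_monomial m x \<sigma>))"
    unfolding std_poly_eq
    by (rule sum.reindex_bij_witness[of _ "(\<circ>) \<tau>" "(\<circ>) \<tau>"])
       (use \<tau> in \<open>auto simp: \<tau>\<tau> permutes_compose evenperm_transpose_comp[where A = "{1..m}"]
          \<tau>_def simp del: upt_Suc\<close>)
  also have "\<dots> = - v"
    by (simp only: v std_poly_eq sum_negf)
  finally show ?thesis
    unfolding std_image_def by (metis rangeI)
qed

text \<open>The Leibniz rule for the derivation \<open>comm _ y\<close>. Distinctness of
  \<open>ks\<close> ensures that the update at \<open>j\<close> alters exactly one factor.\<close>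

lemma comm_prod_list_left:
  fixes f :: "'b \<Rightarrow> 'a::{ring, monoid_mult}"
  assumes "distinct ks"
  shows "comm (prod_list (map f ks)) y =
    (\<Sum>j\<in>set ks. prod_list (map (f(j := comm (f j) y)) ks))"
  using assms
proof (induction ks)
  case Nil
  then show ?case
    by (simp add: comm_def)
next
  case (Cons k ks)
  define Q where "Q j xs = prod_list (map (f(j := comm (f j) y)) xs)" for j xs
  have "map (f(k := comm (f k) y)) ks = map f ks"
    using Cons.prems by auto
  then have Qk: "Q k (k # ks) = comm (f k) y * prod_list (map f ks)"
    by (simp only: Q_def list.map prod_list.Cons fun_upd_same)
  have "Q j (k # ks) = f k * Q j ks" if "j \<in> set ks" for j
    using Cons.prems that by (auto simp: Q_def)
  then have "(\<Sum>j\<in>set (k # ks). Q j (k # ks)) =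
      comm (f k) y * prod_list (map f ks) + f k * (\<Sum>j\<in>set ks. Q j ks)"
    using Cons.prems by (simp add: Qk sum_distrib_left)
  also have "(\<Sum>j\<in>set ks. Q j ks) = comm (prod_list (map f ks)) y"
    using Cons by (simp only: Q_def distinct.simps)
  finally show ?case
    by (simp only: Q_def comm_mult_left list.map prod_list.Cons)
qed

text \<open>The Leibniz rule holds for each monomial, and multilinearity of S_m lets the sums over
  permutations and over variables be exchanged.\<close>

lemma comm_std_poly_left:
  fixes x :: "nat \<Rightarrow> 'a::{ring, monoid_mult}"
  shows "comm (std_poly m x) y = (\<Sum>k\<in>{1..m}. std_poly m (x(k := comm (x k) y)))"
proof -
  have perm: "comm (perm_monomial m x \<sigma>) y =
      (\<Sum>k\<in>{1..m}. perm_monomial m (x(k := comm (x k) y)) \<sigma>)"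
    if \<sigma>: "\<sigma> permutes {1..m}" for \<sigma>
  proof -
    have "comm (perm_monomial m x \<sigma>) y =
      (\<Sum>j\<in>{1..m}. prod_list (map ((\<lambda>i. x (\<sigma> i))(j := comm (x (\<sigma> j)) y)) [1..<Suc m]))"
      by (subst comm_prod_list_left) (simp_all add: atLeastLessThanSuc_atLeastAtMost del: upt_Suc)
    also have "\<dots> = (\<Sum>j\<in>{1..m}. perm_monomial m (x(\<sigma> j := comm (x (\<sigma> j)) y)) \<sigma>)"
      using permutes_inj[OF \<sigma>]
      by (intro sum.cong arg_cong[where f = prod_list] map_cong) (auto simp: inj_eq)
    \<comment> \<open>Passing from the position \<open>j\<close> to the variable
      \<open>k = \<sigma> j\<close> makes the altered argument tuple independent of
      \<open>\<sigma>\<close>, as the later exchange of sums requires.\<close>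
    also have "\<dots> = (\<Sum>k\<in>{1..m}. perm_monomial m (x(k := comm (x k) y)) \<sigma>)"
      by (rule sum.reindex_bij_betw[OF permutes_imp_bij[OF \<sigma>]])
    finally show ?thesis .
  qed
  have "comm (std_poly m x) y = (\<Sum>\<sigma> | \<sigma> permutes {1..m}. \<Sum>k\<in>{1..m}.
     if evenperm \<sigma> then perm_monomial m (x(k := comm (x k) y)) \<sigma>
     else - perm_monomial m (x(k := comm (x k) y)) \<sigma>)"
    unfolding std_poly_eq comm_sum_left
    by (intro sum.cong refl, rename_tac \<sigma>, case_tac "evenperm \<sigma>")
       (simp_all only: mem_Collect_eq perm comm_minus_left sum_negf if_True if_False)
  also have "\<dots> = (\<Sum>k\<in>{1..m}. std_poly m (x(k := comm (x k) y)))"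
    unfolding std_poly_eq by (rule sum.swap)
  finally show ?thesis .
qed

text \<open>The commutator is minus a sum of \<open>m\<close> values of S_m, whatever
  \<open>x\<close> is, and the sign is absorbed by the values.\<close>

lemma bounded_sums_comm_std_image:
  fixes v :: "'a::{ring, monoid_mult}"
  assumes "m > 1" "v \<in> std_image m"
  shows "bounded_sums (std_image m) (\<lambda>x. comm x v)"
proof -
  obtain a where v: "v = std_poly m a"
    using assms(2) unfolding std_image_def by blast
  have "bounded_sums (std_image m) (\<lambda>y. - (\<Sum>k\<in>{1..m}. std_poly m (a(k := comm (a k) y))))"
    by (intro bounded_sums_minus bounded_sums_sum bounded_sumsI_mem std_image_minus assms)
       (auto simp: std_image_def)
  then show ?thesis
    by (subst comm_swap) (simp add: v comm_std_poly_left)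
qed

text \<open>By induction with the Leibniz rule in the second argument: each term replaces one factor
  of \<open>p\<close> by a bounded sum of values of S_m, so the number of factors stays
  \<open>k\<close>.\<close>

lemma bounded_sums_comm_prods_of:
  fixes p :: "'a::{ring, monoid_mult}"
  assumes "m > 1" "p \<in> prods_of (std_image m) k"
  shows "bounded_sums (prods_of (std_image m) k) (\<lambda>x. comm x p)"
  using assms(2)
proof (induction k arbitrary: p)
  case 0
  then show ?case
    by (simp add: prods_of_0)
next
  case (Suc k)
  then obtain v q where p: "p = v * q" "v \<in> std_image m" "q \<in> prods_of (std_image m) k"
    by (elim prods_of_SucE)
  have "bounded_sums (prods_of (std_image m) (Suc 0 + k)) (\<lambda>x. comm x v * q)"
    using bounded_sums_comm_std_image[OF assms(1) p(2)] p(3)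
    by (intro bounded_sums_mult_const) (simp_all add: prods_of_Suc_0)
  moreover have "bounded_sums (prods_of (std_image m) (Suc 0 + k)) (\<lambda>x. v * comm x q)"
    using Suc.IH[OF p(3)] p(2)
    by (intro bounded_sums_const_mult) (simp_all add: prods_of_Suc_0)
  ultimately show ?case
    using bounded_sums_add by (fastforce simp: p(1) comm_mult_right)
qed

lemma bounded_sums_comm_group_closure:
  fixes r :: "'a::{ring, monoid_mult}"
  assumes "m > 1" "k > 0" "r \<in> group_closure (prods_of (std_image m) k)"
  shows "bounded_sums (prods_of (std_image m) k) (\<lambda>x. comm x r)"
  using assms(3)
proof induction
  case (base s)
  then show ?case
    \<comment> \<open>The base rule of \<open>group_closure\<close> also admits 0, which need not be
      a product of length \<open>k\<close>.\<close>
    by (cases "s = 0") (auto intro: bounded_sums_comm_prods_of assms)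
next
  case (diff s t)
  have "- a \<in> prods_of (std_image m) k" if "a \<in> prods_of (std_image m) k" for a :: 'a
    using std_image_minus[OF assms(1)] assms(2) that by (rule prods_of_minus)
  with diff show ?case
    unfolding comm_diff_right by (intro bounded_sums_diff)
qed

text \<open>Forgetting the bound leaves the fact that the span of the products of length
  \<open>k\<close> is a Lie ideal.\<close>

lemma comm_group_closure_prods_of:
  fixes r :: "'a::{ring, monoid_mult}"
  assumes "m > 1" "k > 0" "r \<in> group_closure (prods_of (std_image m) k)"
  shows "comm r y \<in> group_closure (prods_of (std_image m) k)"
  using bounded_sums_in_group_closure[OF bounded_sums_comm_group_closure[OF assms], of y]
  by (subst comm_swap) simp

text \<open>Pairing each even \<open>\<sigma>\<close> with the odd
  \<open>\<sigma> \<circ> \<tau>\<close> gives two monomials that differ only in the order of their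
  first two factors, so their difference is a right multiple of a commutator.\<close>

lemma std_poly_in_ideal:
  fixes J :: "'a::{ring, monoid_mult} set"
  assumes "m > 1" and zero: "0 \<in> J" and add: "\<And>a b. a \<in> J \<Longrightarrow> b \<in> J \<Longrightarrow> a + b \<in> J"
    and right: "\<And>a y. a \<in> J \<Longrightarrow> a * y \<in> J" and comm: "\<And>a b. comm a b \<in> J"
  shows "std_poly m x \<in> J"
proof -
  define \<tau> where "\<tau> = transpose (1::nat) 2"
  have \<tau>: "\<tau> permutes {1..m}"
    unfolding \<tau>_def using assms(1) by (intro permutes_swap_id) auto
  have \<tau>\<tau>: "\<sigma> \<circ> \<tau> \<circ> \<tau> = \<sigma>" for \<sigma> :: "nat \<Rightarrow> nat"
    by (simp add: \<tau>_def fun_eq_iff)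
  have even: "evenperm (\<sigma> \<circ> \<tau>) \<longleftrightarrow> \<not> evenperm \<sigma>" if "\<sigma> permutes {1..m}" for \<sigma>
    using evenperm_transpose_comp(2)[OF that] by (simp add: \<tau>_def)
  define P where "P \<sigma> = perm_monomial m x \<sigma>" for \<sigma>
  define E where "E = {\<sigma>. \<sigma> permutes {1..m} \<and> evenperm \<sigma>}"
  have fin: "finite {\<sigma>. \<sigma> permutes {1..m}}"
    by (simp add: finite_permutations)
  have odd: "(\<Sum>\<sigma> | \<sigma> permutes {1..m} \<and> \<not> evenperm \<sigma>. - P \<sigma>) = (\<Sum>\<sigma>\<in>E. - P (\<sigma> \<circ> \<tau>))"
    by (rule sum.reindex_bij_witness[of _ "\<lambda>\<sigma>. \<sigma> \<circ> \<tau>" "\<lambda>\<sigma>. \<sigma> \<circ> \<tau>"])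
       (use \<tau> in \<open>auto simp: \<tau>\<tau> E_def even permutes_compose\<close>)
  have "std_poly m x = (\<Sum>\<sigma>\<in>E. P \<sigma>) + (\<Sum>\<sigma> | \<sigma> permutes {1..m} \<and> \<not> evenperm \<sigma>. - P \<sigma>)"
    unfolding std_poly_eq P_def[symmetric] E_def using fin
    by (simp add: sum.If_cases Int_def)
  also have "\<dots> = (\<Sum>\<sigma>\<in>E. P \<sigma> - P (\<sigma> \<circ> \<tau>))"
    unfolding odd by (simp add: sum_subtractf sum_negf)
  also have "\<dots> \<in> J"
  proof -
    have "P \<sigma> - P (\<sigma> \<circ> \<tau>) \<in> J" for \<sigma>
    proof -
      have upt: "[1..<Suc m] = 1 # 2 # [3..<Suc m]"
        using assms(1) by (simp add: upt_conv_Cons numeral_2_eq_2 numeral_3_eq_3 del: upt_Suc)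
      have "map (\<lambda>i. x ((\<sigma> \<circ> \<tau>) i)) [3..<Suc m] = map (\<lambda>i. x (\<sigma> i)) [3..<Suc m]"
        by (auto simp: \<tau>_def transpose_def)
      then have "P (\<sigma> \<circ> \<tau>) = x (\<sigma> 2) * (x (\<sigma> 1) *
          prod_list (map (\<lambda>i. x (\<sigma> i)) [3..<Suc m]))"
        unfolding P_def upt by (simp only: list.map prod_list.Cons) (simp add: \<tau>_def)
      then have "P \<sigma> - P (\<sigma> \<circ> \<tau>) =
          comm (x (\<sigma> 1)) (x (\<sigma> 2)) * prod_list (map (\<lambda>i. x (\<sigma> i)) [3..<Suc m])"
        by (simp only: P_def upt list.map prod_list.Cons comm_def left_diff_distrib mult.assoc)
      then show ?thesis
        using right[OF comm] by simp
    qed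
    then show ?thesis
      by (induction E rule: infinite_finite_induct) (auto intro: zero add)
  qed
  finally show ?thesis .
qed

section \<open>The ideal of bounded elements\<close>

text \<open>This rests on \<open>x * comm u r = comm (x * u) r - comm x r * u\<close>, where
  \<open>r\<close> is read in two ways: in the first term as an element of R, the span of the
  products of length \<open>n\<close>; in the second as an element of the span for
  \<open>n - 1\<close>, the missing factor being supplied by \<open>u\<close>.\<close>

lemma bounded_sums_mult_right_comm:
  fixes u r :: "'a::{ring, monoid_mult}"
  assumes "m > 1" "n > 1"
    and span: "group_closure (prods_of (std_image m) n) = (UNIV :: 'a set)"
    and u: "u \<in> group_closure (std_image m)"
    and r: "r \<in> group_closure (prods_of (std_image m) (n - 1))"
  shows "bounded_sums (prods_of (std_image m) n) (\<lambda>x. x * comm u r)"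
proof -
  have neg: "- a \<in> prods_of (std_image m) n" if "a \<in> prods_of (std_image m) n" for a :: 'a
    using std_image_minus[OF assms(1)] _ that by (rule prods_of_minus) (use assms(2) in auto)
  have xu: "bounded_sums (prods_of (std_image m) n) (\<lambda>x. comm (x * u) r)"
    using span assms(1,2)
    by (intro bounded_sums_compose[OF bounded_sums_comm_group_closure]) auto
  have xr: "bounded_sums (prods_of (std_image m) (n - 1)) (\<lambda>x. comm x r)"
    using r assms by (intro bounded_sums_comm_group_closure) auto
  have "bounded_sums (prods_of (std_image m) n) (\<lambda>x. comm x r * u)"
    using u
  proof induction
    case (base v)
    show ?case
    proof (cases "v = 0")
      case False
      with base have "v \<in> prods_of (std_image m) (Suc 0)"
        by (simp add: prods_of_Suc_0)
      from bounded_sums_mult_const[OF xr this] show ?thesis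
        using assms(2) by simp
    qed simp
  next
    case (diff s t)
    then show ?case
      unfolding right_diff_distrib by (intro bounded_sums_diff neg)
  qed
  from bounded_sums_diff[OF xu this neg] show ?thesis
    by (simp add: comm_mult_left)
qed

text \<open>Moving \<open>y\<close> to the left of \<open>comm u r\<close> costs
  \<open>x * comm (comm u r) y\<close>. The Jacobi identity splits this into terms of the kind
  already treated, because both spans are Lie ideals.\<close>

lemma bounded_sums_ideal_comm:
  fixes u r y :: "'a::{ring, monoid_mult}"
  assumes "m > 1" "n > 1"
    and span: "group_closure (prods_of (std_image m) n) = (UNIV :: 'a set)"
    and u: "u \<in> group_closure (std_image m)"
    and r: "r \<in> group_closure (prods_of (std_image m) (n - 1))"
  shows "bounded_sums (prods_of (std_image m) n) (\<lambda>x. x * (comm u r * y))"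
proof -
  note bdd = bounded_sums_mult_right_comm[OF assms(1-3)]
  have uy: "comm u y \<in> group_closure (std_image m)"
    using comm_group_closure_prods_of[OF assms(1), of "Suc 0" u y] u
    by (simp add: prods_of_Suc_0)
  have ry: "comm r y \<in> group_closure (prods_of (std_image m) (n - 1))"
    using comm_group_closure_prods_of[OF assms(1) _ r] assms(2) by simp
  have "x * (comm u r * y) = (x * y) * comm u r + x * comm (comm u r) y" for x
    by (simp add: comm_def[of "comm u r"] right_diff_distrib mult.assoc)
  then have "x * (comm u r * y) =
      (x * y) * comm u r + (x * comm (comm u y) r + x * comm u (comm r y))" for x
    by (simp only: comm_jacobi[of u r y] distrib_left)
  then show ?thesis
    using bounded_sums_add[OF bounded_sums_compose[OF bdd[OF u r], of "\<lambda>x. x * y"]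
        bounded_sums_add[OF bdd[OF uy r] bdd[OF u ry]]]
    by simp
qed

lemma bounded_sums_mult_right:
  fixes s :: "'a::{ring, monoid_mult}"
  assumes "m > 1" "n > 1"
    and span: "group_closure (prods_of (std_image m) n) = (UNIV :: 'a set)"
  shows "bounded_sums (prods_of (std_image m) n) (\<lambda>x. x * s)"
proof -
  define V where "V = (std_image m :: 'a set)"
  \<comment> \<open>With I the left ideal of all \<open>r\<close> such that right multiplication by
    \<open>r\<close> is bounded, \<open>J\<close> is the set of \<open>r\<close> with
    \<open>r * y\<close> in I for all \<open>y\<close>: the largest two-sided ideal inside
    I.\<close>
  define J where "J = {r :: 'a. \<forall>y. bounded_sums (prods_of V n) (\<lambda>x. x * (r * y))}"
  have neg: "- a \<in> prods_of V n" if "a \<in> prods_of V n" for a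
    using std_image_minus[OF assms(1)] _ that unfolding V_def
    by (rule prods_of_minus) (use assms(2) in auto)
  have J0: "0 \<in> J"
    by (simp add: J_def)
  have Jadd: "a + b \<in> J" if "a \<in> J" "b \<in> J" for a b
    using that unfolding J_def by (simp add: distrib_left distrib_right bounded_sums_add)
  have Jdiff: "a - b \<in> J" if "a \<in> J" "b \<in> J" for a b
    using that neg unfolding J_def
    by (simp add: left_diff_distrib right_diff_distrib bounded_sums_diff)
  have Jr: "a * y \<in> J" if "a \<in> J" for a y
    using that unfolding J_def by (simp add: mult.assoc)
  have Jl: "y * a \<in> J" if "a \<in> J" for a y
  proof -
    \<comment> \<open>A left factor \<open>y\<close> is absorbed by substituting
      \<open>x * y\<close> for \<open>x\<close>.\<close>
    have "bounded_sums (prods_of V n) (\<lambda>x. (x * y) * (a * z))" for z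
      using that unfolding J_def by (auto intro: bounded_sums_compose[where h = "\<lambda>x. x * y"])
    then show ?thesis
      unfolding J_def by (simp add: mult.assoc)
  qed
  have VW: "comm v w \<in> J" if "v \<in> V" "w \<in> prods_of V (n - 1)" for v w
    using that bounded_sums_ideal_comm[OF assms, of v w]
    unfolding J_def V_def by (auto intro: group_closure.base)
  \<comment> \<open>Lengthening by \<open>n - 2\<close> gives length \<open>2 * (n - 1)\<close>, so
    R is spanned by products of two elements of \<open>prods_of V (n - 1)\<close>.\<close>
  have "group_closure (prods_of V (n + (n - 2))) = UNIV"
    using group_closure_prods_of_add_UNIV[OF span, of "n - 2"] assms(2) by (simp add: V_def)
  moreover have "n + (n - 2) = (n - 1) + (n - 1)"
    using assms(2) by simp
  \<comment> \<open>The next two claims extend commutation modulo \<open>J\<close>, first in the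
    second argument and then in the first: a derivation that maps the factors into the ideal
    \<open>J\<close> maps their products into \<open>J\<close>.\<close>
  ultimately have WW: "group_closure (prods_of V ((n - 1) + (n - 1))) = UNIV"
    by simp
  have VR: "comm v r \<in> J" if v: "v \<in> V" for v r
  proof -
    have "prods_of V ((n - 1) + (n - 1)) \<subseteq> {r. comm v r \<in> J}"
    proof
      fix p assume "p \<in> prods_of V ((n - 1) + (n - 1))"
      then obtain w w' where "p = w * w'" "w \<in> prods_of V (n - 1)" "w' \<in> prods_of V (n - 1)"
        by (rule prods_of_addE)
      then show "p \<in> {r. comm v r \<in> J}"
        using VW[OF v] by (simp add: comm_mult_right Jadd Jr Jl)
    qed
    then have "group_closure (prods_of V ((n - 1) + (n - 1))) \<subseteq> {r. comm v r \<in> J}"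
      by (rule group_closure_subset) (auto simp: J0 comm_diff_right Jdiff)
    then show ?thesis
      unfolding WW by auto
  qed
  have VkR: "comm p r \<in> J" if "p \<in> prods_of V k" for p r k
    using that
  proof (induction k arbitrary: p)
    case 0
    then show ?case
      by (simp add: prods_of_0 comm_def J0)
  next
    case (Suc k)
    then obtain v q where "p = v * q" "v \<in> V" "q \<in> prods_of V k"
      by (elim prods_of_SucE)
    then show ?case
      using VR Suc.IH by (simp add: comm_mult_left Jadd Jr Jl)
  qed
  have RR: "comm a r \<in> J" for a r
  proof -
    have "group_closure (prods_of V n) \<subseteq> {a. comm a r \<in> J}"
      by (rule group_closure_subset) (auto simp: VkR J0 comm_diff_left Jdiff)
    then show ?thesis
      using span unfolding V_def by auto
  qed
  \<comment> \<open>Now R/J is commutative, so S_m vanishes on it. As \<open>n > 0\<close>, every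
    product of length \<open>n\<close> has a factor in \<open>V\<close>, and \<open>J\<close> is all
    of R.\<close>
  have "V \<subseteq> J"
    unfolding V_def std_image_def using std_poly_in_ideal[OF assms(1) J0 Jadd Jr RR] by auto
  have "prods_of V n \<subseteq> J"
  proof
    fix p assume "p \<in> prods_of V n"
    moreover have "n = Suc (n - 1)"
      using assms(2) by simp
    ultimately obtain v q where "p = v * q" "v \<in> V"
      by (metis prods_of_SucE)
    then show "p \<in> J"
      using \<open>V \<subseteq> J\<close> Jr by blast
  qed
  then have "group_closure (prods_of V n) \<subseteq> J"
    by (rule group_closure_subset) (auto simp: J0 Jdiff)
  then have "s \<in> J"
    using span unfolding V_def by auto
  then have "bounded_sums (prods_of V n) (\<lambda>x. x * (s * 1))"
    unfolding J_def by blast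
  then show ?thesis
    by (simp add: V_def)
qed

theorem theorem14:
  fixes m n :: nat
  assumes "m > 1" and "n > 1"
    and "(UNIV :: 'a::{ring, monoid_mult} set) = group_closure (prods_of (std_image m) n)"
  shows "\<exists>N::nat. \<forall>x::'a. \<exists>a::nat \<Rightarrow> 'a.
    (\<forall>i\<in>{1..N}. a i \<in> prods_of (std_image m) n) \<and> x = (\<Sum>i=1..N. a i)"
proof -
  \<comment> \<open>Boundedness of multiplication by 1, that is, of the identity map, is the claim
    itself.\<close>
  have "bounded_sums (prods_of (std_image m) n) (\<lambda>x :: 'a. x * 1)"
    using bounded_sums_mult_right[OF assms(1,2) assms(3)[symmetric]] .
  then obtain N where N:
    "\<And>x :: 'a. \<exists>ys. length ys = N \<and> set ys \<subseteq> prods_of (std_image m) n \<and> x = sum_list ys"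
    unfolding bounded_sums_def by auto
  have "\<exists>a. (\<forall>i\<in>{1..N}. a i \<in> prods_of (std_image m) n) \<and> x = (\<Sum>i=1..N. a i)" for x :: 'a
  proof -
    obtain ys where ys: "length ys = N" "set ys \<subseteq> prods_of (std_image m) n" "x = sum_list ys"
      using N[of x] by blast
    \<comment> \<open>The shift by one reconciles list positions, counted from 0, with summands
      counted from 1.\<close>
    have "x = (\<Sum>i=1..N. ys ! (i - 1))"
      by (simp add: ys(1,3) sum_list_sum_nth atLeast0LessThan sum.atLeast1_atMost_eq)
    moreover have "\<forall>i\<in>{1..N}. ys ! (i - 1) \<in> prods_of (std_image m) n"
      using ys(1,2) by (auto intro!: subsetD[OF ys(2)] nth_mem)
    ultimately show ?thesis
      by (intro exI[of _ "\<lambda>i. ys ! (i - 1)"] conjI)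
  qed
  then show ?thesis
    by blast
qed

end
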